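(* Let $x$ be a real number with $0<x<1/e$ (so that $-x$ is negative and $-x>-1/e$). Define a sequence by $y_1'=x$ and, for $n\ge 1$, $$l_n'=-\{3y_n'-2+\ln(x/y_n')\},\qquad m_n'=-2y_n'\{y_n'+\ln(x/y_n')\},$$ $$a_n'=\tfrac12\left(l_n'-\sqrt{l_n'^2+4m_n'}\right),\qquad y_{n+1}'=y_n'+a_n' .$$ Assume that all the numbers $y_n'$ ($n\ge 1$) are real and positive. Then the smaller of the two real solutions $y$ of $-ye^{-y}=-x$ (i.e. of $W(-x)=-y$) is evaluated to any required accuracy by $y_n'+a_n'$ with $n$ large enough; that is, $\lim_{n\to\infty}(y_n'+a_n')=y$, where $y\in(0,1)$ and $ye^{-y}=x$.
   Context: $W$ denotes the real (two-branched) Lambert W relation: $W(-x)=-y$ means $-ye^{-y}=-x$. For $0<x<1/e$ the equation $ye^{-y}=x$ has exactly two real solutions, one in $(0,1)$ and one in $(1,\infty)$. The integer $n$ is the number of times the correction is applied. *)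

theory Defs
  imports Complex_Main
begin

text \<open>The two-branched real Lambert relation: \<open>lambert_W z w\<close> is read ``\<open>W(z) = w\<close>''.
  It is a relation rather than a function, since for \<open>-1/e < z < 0\<close> there are two such \<open>w\<close>.\<close>

definition lambert_W :: "real \<Rightarrow> real \<Rightarrow> bool" where
  "lambert_W z w \<longleftrightarrow> w * exp w = z"

end

theory Submission
  imports Defs "HOL-Probability.Characteristic_Functions"
begin

text \<open>
  Write \<open>g y = y + ln (x / y)\<close>. On \<open>(0, 1]\<close> this function is strictly decreasing and its only
  zero is the smaller solution \<open>u\<close> of \<open>y e\<^sup>-\<^sup>y = x\<close>. Replacing \<open>ln (z / y)\<close> by its Pade approximant
  \<open>2 (z - y) / (z + y)\<close> turns \<open>g z = 0\<close> into the quadratic equation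
  \<open>(ln (x / y) + z) (y + z) = 2 (z - y)\<close>, whose smaller root \<open>z\<close> is the next iterate
  (lemma \<open>pade_step_smaller_root\<close>).

  The approximant is at most \<open>ln (z / y)\<close> for \<open>z \<ge> y\<close> and at least \<open>ln (z / y)\<close> for \<open>z \<le> y\<close>. Hence
  a step upwards overshoots \<open>u\<close>, and so does a step downwards: the iterates lie alternately in
  \<open>[x, u]\<close> and in \<open>[u, 1]\<close> (lemmas \<open>pade_step_from_below\<close> and \<open>pade_step_from_above\<close>).

  Alternation alone does not give convergence, because the iteration can have genuine 2-cycles
  \<open>s \<mapsto> t \<mapsto> s\<close>. Put \<open>d = (t - s) / (t + s)\<close> and \<open>e = 1 - (t + s) / 2\<close>. A 2-cycle requires
  \<open>artanh d = d (1 + e)\<close>, whereas choosing the smaller root means \<open>d \<le> e\<close>. These two are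
  compatible only for \<open>d\<close> close to \<open>1\<close>. The starting value \<open>x\<close> excludes this range: for \<open>s \<ge> x\<close> one
  has \<open>g s \<le> s\<close>, which says \<open>(1 + d) (1 + e) \<le> 2\<close> and forces \<open>d \<le> 1 / 2\<close>, where
  \<open>artanh d < d (1 + d)\<close>. The same inequality shows that two successive steps from a point of
  \<open>[x, u)\<close> lead upwards (lemmas \<open>two_step_strict\<close> and \<open>two_step_increases\<close>).

  So the iterates below \<open>u\<close> increase to a limit \<open>S\<close>, those above converge to the successor \<open>T\<close> of
  \<open>S\<close>, and \<open>S\<close> is in turn the successor of \<open>T\<close>. As there is no nontrivial 2-cycle,
  \<open>S = T = u\<close>.
\<close>

section \<open>The equation \<open>y e\<^sup>-\<^sup>y = x\<close>\<close>

lemma mult_exp_minus_strict_increasing: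
  assumes "a < b" "b \<le> (1::real)"
  shows "a * exp (- a) < b * exp (- b)"
proof (rule DERIV_pos_imp_increasing_open[OF assms(1)])
  fix t assume "a < t" "t < b"
  have "((\<lambda>t. t * exp (- t)) has_real_derivative (1 - t) * exp (- t)) (at t)"
    by (auto intro!: derivative_eq_intros simp: algebra_simps)
  moreover have "(1 - t) * exp (- t) > 0" using \<open>t < b\<close> assms by simp
  ultimately show "\<exists>D. ((\<lambda>t. t * exp (- t)) has_real_derivative D) (at t) \<and> 0 < D" by blast
qed (intro continuous_intros)

lemma mult_exp_minus_strict_decreasing:
  assumes "a < b" "(1::real) \<le> a"
  shows "b * exp (- b) < a * exp (- a)"
proof (rule DERIV_neg_imp_decreasing_open[OF assms(1)])
  fix t assume "a < t" "t < b"
  have "((\<lambda>t. t * exp (- t)) has_real_derivative (1 - t) * exp (- t)) (at t)"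
    by (auto intro!: derivative_eq_intros simp: algebra_simps)
  moreover have "(1 - t) * exp (- t) < 0" using \<open>a < t\<close> assms by (simp add: mult_neg_pos)
  ultimately show "\<exists>D. ((\<lambda>t. t * exp (- t)) has_real_derivative D) (at t) \<and> D < 0" by blast
qed (intro continuous_intros)

lemma lambert_W_two_branches:
  fixes x :: real
  assumes x: "0 < x" "x < 1 / exp 1"
  obtains u v where "{t. lambert_W (- x) (- t)} = {u, v}" "0 < u" "u < 1" "1 < v"
    "u * exp (- u) = x"
proof -
  let ?f = "\<lambda>t::real. t * exp (- t)"
  have f1: "?f 1 = 1 / exp 1" by (simp add: exp_minus field_simps)
  have cont: "continuous_on S ?f" for S by (intro continuous_intros)
  obtain u where u: "0 \<le> u" "u \<le> 1" "?f u = x"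
    using IVT'[of ?f 0 x 1] x f1 cont by auto
  have "1 < exp (1::real)" by simp
  then have "1 / exp 1 < (1::real)" by (simp add: field_simps)
  then have "x < 1" using x by linarith
  \<comment> \<open>A point with \<open>T e\<^sup>-\<^sup>T \<le> x\<close> is needed; \<open>e\<^sup>T > T\<^sup>2 / 2\<close> gives \<open>T e\<^sup>-\<^sup>T < 2 / T = x\<close> for this choice.\<close>
  define T where "T = 2 / x"
  have T: "T > 1" using x \<open>x < 1\<close> by (simp add: T_def field_simps)
  have "T * T / 2 \<le> exp T"
    using exp_lower_Taylor_quadratic[of T] T by (simp add: power2_eq_square)
  then have "?f T \<le> x" using T x by (simp add: exp_minus T_def field_simps)
  then obtain v where v: "1 \<le> v" "?f v = x"
    using IVT2'[of ?f T x 1] x f1 cont T by auto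
  have u': "u < 1" "0 < u" using u f1 x by (auto simp: order_less_le)
  have v': "1 < v" using v f1 x by (auto simp: order_less_le)
  have "t = u \<or> t = v" if "?f t = x" for t
  proof (cases "t \<le> 1")
    case True
    then show ?thesis
      using mult_exp_minus_strict_increasing[of t u] mult_exp_minus_strict_increasing[of u t] that u
      by linarith
  next
    case False
    then show ?thesis
      using mult_exp_minus_strict_decreasing[of t v] mult_exp_minus_strict_decreasing[of v t] that v
      by linarith
  qed
  then have "{t. lambert_W (- x) (- t)} = {u, v}"
    using u v by (auto simp: lambert_W_def)
  then show ?thesis using that u u' v' by blast
qed

text \<open>The defect \<open>y + ln (x / y)\<close> is \<open>ln x - ln (y e\<^sup>-\<^sup>y)\<close>, so up to \<open>1\<close> its sign compares \<open>y\<close> with \<open>u\<close>.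
  It is how the position of an iterate relative to \<open>u\<close> is read off.\<close>

lemma defect_nonneg_iff:
  fixes x y u :: real
  assumes "0 < x" "0 < y" "y \<le> 1" "u \<le> 1" "u * exp (- u) = x"
  shows "0 \<le> y + ln (x / y) \<longleftrightarrow> y \<le> u"
    and "y + ln (x / y) = 0 \<longleftrightarrow> y = u"
proof -
  have eq: "y + ln (x / y) = ln x - ln (y * exp (- y))"
    using assms by (simp add: ln_div ln_mult)
  have *: "y * exp (- y) > 0" using assms by simp
  show "0 \<le> y + ln (x / y) \<longleftrightarrow> y \<le> u"
    unfolding eq using * assms mult_exp_minus_strict_increasing[of y u]
      mult_exp_minus_strict_increasing[of u y]
    by (cases y u rule: linorder_cases) auto
  show "y + ln (x / y) = 0 \<longleftrightarrow> y = u"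
    unfolding eq using * assms mult_exp_minus_strict_increasing[of y u]
      mult_exp_minus_strict_increasing[of u y]
    by (cases y u rule: linorder_cases) auto
qed

section \<open>Rational bounds for the logarithm\<close>

lemma ln_ratio_ge:
  fixes d :: real
  assumes "0 \<le> d" "d < 1"
  shows "2 * d \<le> ln (1 + d) - ln (1 - d)"
proof -
  let ?h = "\<lambda>z::real. ln (1 + z) - ln (1 - z) - 2 * z"
  have "?h 0 \<le> ?h d"
  proof (rule DERIV_nonneg_imp_nondecreasing[OF assms(1)])
    fix z assume z: "0 \<le> z" "z \<le> d"
    have "(?h has_real_derivative (1 / (1 + z) + 1 / (1 - z) - 2)) (at z)"
      using z assms by (auto intro!: derivative_eq_intros)
    moreover have "z * z < 1" using mult_strict_mono[of z 1 z 1] z assms by simp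
    then have "1 / (1 + z) + 1 / (1 - z) - 2 = 2 * z\<^sup>2 / ((1 + z) * (1 - z))"
      using z assms by (simp add: field_simps power2_eq_square)
    then have "1 / (1 + z) + 1 / (1 - z) - 2 \<ge> 0" using z assms by simp
    ultimately show "\<exists>D. (?h has_real_derivative D) (at z) \<and> 0 \<le> D" by blast
  qed
  then show ?thesis by simp
qed

text \<open>The left side is \<open>2 artanh d\<close>. The bound fails for \<open>d\<close> near \<open>1\<close>; on the range stated the derivative
  of the difference has the sign of \<open>2 - d - 2 d\<^sup>2 > 0\<close>.\<close>

lemma ln_ratio_less:
  fixes d :: real
  assumes "0 < d" "d \<le> 1 / 2"
  shows "ln (1 + d) - ln (1 - d) < 2 * d + 2 * d\<^sup>2"
proof -
  let ?h = "\<lambda>z::real. 2 * z + 2 * z\<^sup>2 - (ln (1 + z) - ln (1 - z))"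
  have "?h 0 < ?h d"
  proof (rule DERIV_pos_imp_increasing_open[OF assms(1)])
    fix z assume z: "0 < z" "z < d"
    have "(?h has_real_derivative (2 + 4 * z - (1 / (1 + z) + 1 / (1 - z)))) (at z)"
      using z assms by (auto intro!: derivative_eq_intros)
    moreover have "z * z < 1" using mult_strict_mono[of z 1 z 1] z assms by simp
    then have "2 + 4 * z - (1 / (1 + z) + 1 / (1 - z))
        = 2 * z * (2 - z - 2 * z\<^sup>2) / ((1 + z) * (1 - z))"
      using z assms by (simp add: field_simps power2_eq_square)
    moreover have "z\<^sup>2 \<le> (1 / 2)\<^sup>2" using z assms by (intro power_mono) auto
    then have "2 - z - 2 * z\<^sup>2 > 0" using z assms by (simp add: power2_eq_square)
    ultimately show "\<exists>D. (?h has_real_derivative D) (at z) \<and> 0 < D" using z assms by force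
  qed (use assms in \<open>auto intro!: continuous_intros\<close>)
  then show ?thesis by simp
qed

text \<open>The half difference \<open>d\<close> relative to the mean of \<open>s\<close> and \<open>t\<close> is the variable in which the Pade
  approximant of \<open>ln (t / s)\<close> becomes simply \<open>2 d\<close>.\<close>

lemma ln_diff_eq_ln_ratio:
  fixes s t :: real
  assumes "0 < s" "0 < t"
  defines "d \<equiv> (t - s) / (t + s)"
  shows "ln t - ln s = ln (1 + d) - ln (1 - d)"
proof -
  have "1 + d = 2 * t / (t + s)" "1 - d = 2 * s / (t + s)"
    using assms by (auto simp: d_def field_simps)
  then show ?thesis using assms by (simp add: ln_div ln_mult)
qed

lemma ln_diff_ge:
  fixes s t :: real
  assumes "0 < s" "s \<le> t"
  shows "2 * (t - s) / (t + s) \<le> ln t - ln s"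
  using ln_ratio_ge[of "(t - s) / (t + s)"] ln_diff_eq_ln_ratio[of s t] assms by simp

section \<open>One correction\<close>

text \<open>The quadratic equation for the next iterate \<open>z\<close>. Its two roots add up to \<open>2 - (y + ln (x / y))\<close>,
  so the second conjunct selects the smaller one. Unlike the closed formula with the square root,
  this relation can be tested against other points by factoring, and it visibly passes to limits.\<close>

definition pade_step :: "real \<Rightarrow> real \<Rightarrow> real \<Rightarrow> bool" where
  "pade_step x y z \<longleftrightarrow> (ln (x / y) + z) * (y + z) = 2 * (z - y) \<and> 2 * z \<le> 2 - (y + ln (x / y))"

lemma pade_step_smaller_root:
  fixes x y l m :: real
  assumes "l = - (3 * y - 2 + ln (x / y))" "m = - 2 * y * (y + ln (x / y))"
    "l\<^sup>2 + 4 * m \<ge> 0"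
  shows "pade_step x y (y + 1 / 2 * (l - sqrt (l\<^sup>2 + 4 * m)))"
proof -
  define r where "r = sqrt (l\<^sup>2 + 4 * m)"
  have r: "r \<ge> 0" "r * r = l * l + 4 * m" using assms by (auto simp: r_def power2_eq_square)
  define a where "a = 1 / 2 * (l - r)"
  have "2 * a = l - r" by (simp add: a_def)
  then have "4 * (a * a - l * a - m) = 0" using r(2) by algebra
  then have "a * a - l * a - m = 0" by simp
  then have "(ln (x / y) + (y + a)) * (y + (y + a)) = 2 * ((y + a) - y)"
    by (simp add: assms(1,2) algebra_simps)
  moreover have "2 * a \<le> l" using r by (simp add: a_def)
  ultimately have "pade_step x y (y + a)" by (simp add: pade_step_def assms(1))
  then show ?thesis unfolding a_def r_def .
qed

text \<open>The quadratic as a product over its roots \<open>z\<close> and \<open>2 - (y + ln (x / y)) - z\<close>. Its sign at a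
  point \<open>w\<close> therefore locates \<open>w\<close> relative to the roots; it is used with \<open>w = y\<close>, where the value is
  \<open>2 y\<close> times the defect, and with \<open>w\<close> the iterate preceding \<open>y\<close>.\<close>

lemma pade_step_factor:
  assumes "pade_step x y z"
  shows "(ln (x / y) + w) * (y + w) - 2 * (w - y)
    = (w - z) * (w - (2 - (y + ln (x / y)) - z))"
  using assms unfolding pade_step_def by algebra

text \<open>This says that the two roots of the quadratic have a midpoint greater than \<open>y\<close>. For small \<open>y\<close> it
  holds because the defect is at most \<open>y\<close> when \<open>x \<le> y\<close>; otherwise \<open>ln x < - 1\<close> and
  \<open>ln (1 / y) \<le> 1 / y - 1\<close> make the defect less than \<open>(1 - y)\<^sup>2 / y\<close>, which is at most \<open>2 (1 - y)\<close> from
  \<open>y = 1 / 3\<close> on.\<close>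

lemma defect_bound:
  fixes x y :: real
  assumes x: "0 < x" "x < 1 / exp 1" and y: "x \<le> y" "y < 1"
  shows "2 * y < 2 - (y + ln (x / y))"
proof (cases "y < 1 / 3")
  case True
  have "ln (x / y) \<le> 0" using x y by (simp add: ln_div)
  then show ?thesis using True by simp
next
  case False
  have "ln x < ln (1 / exp 1)" using x by (subst ln_less_cancel_iff) auto
  then have "ln x < - 1" by (simp add: ln_div)
  moreover have "ln (1 / y) \<le> 1 / y - 1" using x y by (intro ln_le_minus_one) auto
  ultimately have "y + ln (x / y) < y + 1 / y - 2" using x y by (simp add: ln_div)
  moreover have "1 / y \<le> 4 - 3 * y"
  proof -
    have "0 \<le> (3 * y - 1) * (1 - y)" using False y by (intro mult_nonneg_nonneg) auto
    then have "1 \<le> (4 - 3 * y) * y" by (simp add: algebra_simps)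
    then show ?thesis using x y by (simp add: pos_divide_le_eq)
  qed
  ultimately show ?thesis by linarith
qed

text \<open>Below \<open>u\<close> the quadratic is nonnegative at \<open>s\<close>, and \<open>s\<close> lies left of the midpoint of the roots;
  hence the step goes upwards. The logarithm exceeds its approximant there, so the defect at \<open>t\<close> is
  no longer positive.\<close>

lemma pade_step_from_below:
  fixes x u s t :: real
  assumes x: "0 < x" "x < 1 / exp 1" and u: "u < 1" "u * exp (- u) = x"
    and s: "x \<le> s" "s \<le> u" and st: "pade_step x s t"
  shows "u \<le> t" "t \<le> 1"
proof -
  let ?g = "s + ln (x / s)"
  have g: "0 \<le> ?g" using defect_nonneg_iff(1)[of x s u] assms by auto
  show t1: "t \<le> 1" using st g by (simp add: pade_step_def)
  have "0 \<le> ?g * (2 * s)" using g x s by simp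
  also have "\<dots> = (s - t) * (s - (2 - ?g - t))"
    using pade_step_factor[OF st, of s] by (simp add: add.commute)
  finally have "0 \<le> (s - t) * (s - (2 - ?g - t))" .
  moreover have "2 * s < 2 - ?g" using defect_bound[of x s] assms by auto
  ultimately have le: "s \<le> t" using st unfolding pade_step_def zero_le_mult_iff by linarith
  have "ln (x / s) + t = 2 * (t - s) / (t + s)"
    using st x s le by (simp add: pade_step_def field_simps)
  then have "t + ln (x / t) \<le> 0"
    using ln_diff_ge[of s t] x s le by (simp add: ln_div)
  then show "u \<le> t"
    using defect_nonneg_iff[of x t u] x s u le t1 by (cases "t \<le> u") auto
qed

text \<open>Above \<open>u\<close> the quadratic is nonpositive at \<open>t\<close>, so \<open>t\<close> lies between the two roots and the step goes
  downwards; the approximant now errs in the other direction, and the step passes \<open>u\<close> again. The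
  second conclusion, that the larger root is at least \<open>t\<close>, serves to locate the iterate
  before \<open>t\<close> relative to the roots.\<close>

lemma pade_step_from_above:
  fixes x u t r :: real
  assumes x: "0 < x" and u: "0 < u" "u < 1" "u * exp (- u) = x"
    and t: "u \<le> t" "t \<le> 1" and st: "pade_step x t r" and r: "0 < r"
  shows "r \<le> u" "t \<le> 2 - (t + ln (x / t)) - r"
proof -
  let ?g = "t + ln (x / t)"
  have g: "?g \<le> 0" using defect_nonneg_iff[of x t u] assms by (cases "t = u") auto
  have "(t - r) * (t - (2 - ?g - r)) = ?g * (2 * t)"
    using pade_step_factor[OF st, of t] by (simp add: add.commute)
  also have "\<dots> \<le> 0" using g u t by (simp add: mult_nonpos_nonneg)
  finally have "(t - r) * (t - (2 - ?g - r)) \<le> 0" .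
  then have le: "r \<le> t" and "t \<le> 2 - ?g - r"
    using st unfolding pade_step_def mult_le_0_iff by linarith+
  then show "t \<le> 2 - ?g - r" by simp
  have "ln (x / t) + r = - (2 * (t - r) / (t + r))"
    using st r le by (simp add: pade_step_def field_simps)
  then have "0 \<le> r + ln (x / r)"
    using ln_diff_ge[of r t] x r le by (simp add: ln_div)
  then show "r \<le> u"
    using defect_nonneg_iff(1)[of x r u] x u r le t by auto
qed

section \<open>Two corrections\<close>

text \<open>The quadratic of the second step, evaluated at the point \<open>s\<close> where the first step started, is
  positive; so \<open>s\<close> is not a root, and there is no 2-cycle through \<open>s\<close>. In the variables \<open>d\<close> and \<open>e\<close>
  the first step reads \<open>s + ln (x / s) = 2 d e\<close>, and the claim becomes \<open>artanh d < d (1 + e)\<close>.\<close>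

lemma two_step_strict:
  fixes x s t :: real
  assumes x: "0 < x" "x \<le> s" and st: "s < t" "pade_step x s t"
  shows "2 * (s - t) < (ln (x / t) + s) * (t + s)"
proof -
  define d where "d = (t - s) / (t + s)"
  define e where "e = 1 - (t + s) / 2"
  have pos: "t + s > 0" using assms by simp
  have d: "d > 0" using assms by (simp add: d_def)
  have ts: "t = (1 - e) * (1 + d)" "s = (1 - e) * (1 - d)"
    using pos by (auto simp: d_def e_def field_simps)
  have "ln (x / s) + t = 2 * d"
    using st x pos by (simp add: pade_step_def d_def field_simps)
  moreover have "s - t = 2 * d * e - 2 * d" unfolding ts by algebra
  ultimately have g: "s + ln (x / s) = 2 * d * e" by linarith
  have "2 * t \<le> 2 - 2 * d * e" using st(2) g by (simp add: pade_step_def)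
  \<comment> \<open>Choosing the smaller root amounts to \<open>d \<le> e\<close>, starting at or above \<open>x\<close> to \<open>(1 + d) (1 + e) \<le> 2\<close>.\<close>
  then have de: "d \<le> e" using ts by (simp add: algebra_simps)
  have "ln (x / s) \<le> 0" using x by (simp add: ln_div)
  then have "d + e + d * e \<le> 1" using g ts by (simp add: algebra_simps)
  moreover have "d * e \<ge> 0" using d de by simp
  ultimately have "d \<le> 1 / 2" using de by linarith
  then have "ln t - ln s < 2 * d + 2 * d\<^sup>2"
    using ln_ratio_less[of d] ln_diff_eq_ln_ratio[of s t] d x st by (simp add: d_def)
  also have "\<dots> \<le> 2 * d + 2 * d * e" using d de by (simp add: power2_eq_square)
  finally have "- (2 * d) < ln (x / t) + s"
    using g x st by (simp add: ln_div)
  then have "- (2 * d) * (t + s) < (ln (x / t) + s) * (t + s)"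
    using pos by (intro mult_strict_right_mono)
  then show ?thesis using pos by (simp add: d_def)
qed

text \<open>
  By \<open>two_step_strict\<close> the point \<open>s\<close> lies outside the interval between the two roots of the second
  step. As \<open>s < t\<close> and \<open>t\<close> is at most the larger root, \<open>s\<close> must lie to the left of the smaller one.\<close>

lemma two_step_increases:
  fixes x u s t r :: real
  assumes x: "0 < x" "x < 1 / exp 1" and u: "0 < u" "u < 1" "u * exp (- u) = x"
    and s: "x \<le> s" "s \<le> u" and st: "pade_step x s t" and tr: "pade_step x t r" and r: "0 < r"
  shows "s \<le> r"
proof -
  have t: "u \<le> t" "t \<le> 1" using pade_step_from_below[OF x u(2,3) s st] .
  have r': "r \<le> u" "t \<le> 2 - (t + ln (x / t)) - r" using pade_step_from_above[OF x(1) u t tr r] .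
  show ?thesis
  proof (cases "s = t")
    case True
    then have "s = u" using s t by simp
    \<comment> \<open>At the fixed point \<open>u\<close> the roots are \<open>u\<close> and \<open>2 - u > 1\<close>; the second is not the smaller one.\<close>
    then have g: "t + ln (x / t) = 0" using defect_nonneg_iff(2)[of x s u] assms True by simp
    moreover have "ln (x / t) + t = 0" using g by simp
    ultimately have "(t - r) * (t - (2 - r)) = 0" using pade_step_factor[OF tr, of t] by auto
    then show ?thesis using True \<open>s = u\<close> r'(1) u by auto
  next
    case False
    then have lt: "s < t" using s t by simp
    have "0 < (s - r) * (s - (2 - (t + ln (x / t)) - r))"
      using two_step_strict[OF x(1) s(1) lt st] pade_step_factor[OF tr, of s] by simp
    then show ?thesis using r' lt by (simp add: zero_less_mult_iff)
  qed
qed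

lemma two_cycle_trivial:
  fixes x s t :: real
  assumes x: "0 < x" "x \<le> s" and st: "s \<le> t" "pade_step x s t" "pade_step x t s"
  shows "s = t"
proof (rule ccontr)
  assume "s \<noteq> t"
  then show False using two_step_strict[OF x _ st(2)] st by (auto simp: pade_step_def)
qed

theorem lemma4:
  fixes x :: real and y l m a :: "nat \<Rightarrow> real"
  assumes x: "0 < x" "x < 1 / exp 1"
    and y_1: "y 1 = x"
    and l: "\<And>n. n \<ge> 1 \<Longrightarrow> l n = - (3 * y n - 2 + ln (x / y n))"
    and m: "\<And>n. n \<ge> 1 \<Longrightarrow> m n = - 2 * y n * (y n + ln (x / y n))"
    and a: "\<And>n. n \<ge> 1 \<Longrightarrow> a n = 1 / 2 * (l n - sqrt ((l n)\<^sup>2 + 4 * m n))"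
    and y_Suc: "\<And>n. n \<ge> 1 \<Longrightarrow> y (n + 1) = y n + a n"
    and y_real: "\<And>n. n \<ge> 1 \<Longrightarrow> (l n)\<^sup>2 + 4 * m n \<ge> 0"
    and y_pos: "\<And>n. n \<ge> 1 \<Longrightarrow> y n > 0"
  shows "\<exists>u v. {t. lambert_W (- x) (- t)} = {u, v} \<and> u < v \<and> 0 < u \<and> u < 1 \<and>
           u * exp (- u) = x \<and> (\<lambda>n. y n + a n) \<longlonglongrightarrow> u"
proof -
  obtain u v where uv: "{t. lambert_W (- x) (- t)} = {u, v}" "0 < u" "u < 1" "1 < v"
    "u * exp (- u) = x"
    using lambert_W_two_branches[OF x] .
  have step: "pade_step x (y n) (y (Suc n))" if "n \<ge> 1" for n
    using pade_step_smaller_root[OF l m y_real, OF that that that] y_Suc[OF that] a[OF that] by simp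
  \<comment> \<open>Counting starts at \<open>y 1 = x < u\<close>: odd indices give the iterates below \<open>u\<close>, even ones those above.\<close>
  define s where "s k = y (Suc (2 * k))" for k
  define t where "t k = y (Suc (Suc (2 * k)))" for k
  have st: "pade_step x (s k) (t k)" and ts: "pade_step x (t k) (s (Suc k))" for k
    using step[of "Suc (2 * k)"] step[of "Suc (Suc (2 * k))"] by (auto simp: s_def t_def)
  have pos: "s k > 0" for k using y_pos by (simp add: s_def)
  have s_bounds: "x \<le> s k \<and> s k \<le> u" for k
  proof (induction k)
    case 0
    have "u * exp (- u) \<le> u * 1" using uv by (intro mult_left_mono) auto
    then show ?case using uv y_1 by (simp add: s_def)
  next
    case (Suc k)
    have "u \<le> t k" "t k \<le> 1"
      using pade_step_from_below[OF x uv(3,5) _ _ st] Suc by auto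
    then have "s (Suc k) \<le> u" using pade_step_from_above(1)[OF x(1) uv(2,3,5) _ _ ts pos] by auto
    moreover have "s k \<le> s (Suc k)"
      using two_step_increases[OF x uv(2,3,5) _ _ st ts pos] Suc by auto
    ultimately show ?case using Suc by simp
  qed
  have t_ge: "u \<le> t k" for k
    using pade_step_from_below(1)[OF x uv(3,5) _ _ st] s_bounds by auto
  have "incseq s"
    using two_step_increases[OF x uv(2,3,5) _ _ st ts pos] s_bounds by (intro incseq_SucI) auto
  then obtain S where S: "s \<longlonglongrightarrow> S" using incseq_convergent s_bounds by metis
  have Sb: "x \<le> S" "S \<le> u"
    using s_bounds S by (auto intro: LIMSEQ_le_const LIMSEQ_le_const2)
  define T where "T = S + 1 / 2 * (- (3 * S - 2 + ln (x / S))
    - sqrt ((- (3 * S - 2 + ln (x / S)))\<^sup>2 + 4 * (- 2 * S * (S + ln (x / S)))))"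
  have "t = (\<lambda>k. s k + 1 / 2 * (- (3 * s k - 2 + ln (x / s k))
    - sqrt ((- (3 * s k - 2 + ln (x / s k)))\<^sup>2 + 4 * (- 2 * s k * (s k + ln (x / s k))))))"
    using y_Suc[of "Suc (2 * _)"] a l m by (simp add: fun_eq_iff s_def t_def)
  moreover have "\<dots> \<longlonglongrightarrow> T"
    unfolding T_def using S Sb x by (intro tendsto_intros) auto
  ultimately have T: "t \<longlonglongrightarrow> T" by simp
  have Tb: "u \<le> T" using t_ge T by (auto intro: LIMSEQ_le_const)
  have pade_step_limit: "pade_step x p q"
    if "P \<longlonglongrightarrow> p" "Q \<longlonglongrightarrow> q" "p > 0" "\<And>k. pade_step x (P k) (Q k)" for P Q p q
  proof -
    have "(\<lambda>k. (ln (x / P k) + Q k) * (P k + Q k)) \<longlonglongrightarrow> (ln (x / p) + q) * (p + q)"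
      "(\<lambda>k. 2 * (Q k - P k)) \<longlonglongrightarrow> 2 * (q - p)"
      "(\<lambda>k. 2 * Q k) \<longlonglongrightarrow> 2 * q"
      "(\<lambda>k. 2 - (P k + ln (x / P k))) \<longlonglongrightarrow> 2 - (p + ln (x / p))"
      using that(1-3) x by (auto intro!: tendsto_intros)
    then show ?thesis
      using that(4) LIMSEQ_unique LIMSEQ_le[of "\<lambda>k. 2 * Q k"] unfolding pade_step_def by auto
  qed
  have "pade_step x S T" "pade_step x T S"
    using pade_step_limit[OF S T _ st] pade_step_limit[OF T LIMSEQ_Suc[OF S] _ ts] Sb Tb x uv by auto
  then have "S = T" using two_cycle_trivial[OF x(1) Sb(1)] Sb Tb by simp
  then have lim: "S = u" "T = u" using Sb Tb by auto
  have "(\<lambda>n. y (Suc n)) \<longlonglongrightarrow> u"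
  proof (rule limseq_even_odd)
    show "(\<lambda>k. y (Suc (2 * k))) \<longlonglongrightarrow> u" using S lim by (simp add: s_def[abs_def])
    show "(\<lambda>k. y (Suc (2 * k + 1))) \<longlonglongrightarrow> u" using T lim by (simp add: t_def[abs_def])
  qed
  then have "(\<lambda>n. y n + a n) \<longlonglongrightarrow> u"
  proof (rule Lim_transform_eventually)
    show "\<forall>\<^sub>F n in sequentially. y (Suc n) = y n + a n"
      using eventually_ge_at_top[of 1] by eventually_elim (use y_Suc in simp)
  qed
  then show ?thesis using uv by (intro exI[of _ u] exI[of _ v]) auto
qed

end
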